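(* Let $a,b,c$ be the (signed) curvatures of three consecutive circles of a chain of circles inscribed in a lens, with $b\neq 0$. Index the curvatures of the circles of the chain consecutively as $(b_n)$ with $b_0=a$, $b_1=b$. Then for all $n$ $$b_n=\alpha\, b_{n-1}-b_{n-2}+\beta,\qquad \alpha=\frac{ab+bc+ca}{b^2}-1,\quad \beta=\frac{b^2-ac}{b},$$ and $b_2=c$, that is, $\alpha b+\beta=a+c$.
   Context: A lens is the region common to the interiors of two congruent circles (the lens circles), or the region outside both of them. A chain of circles inscribed in the lens is a sequence of circles, each tangent to both lens circles, with consecutive circles tangent to each other. The curvature of a circle is $1/\text{radius}$, taken negative for a chain circle that encloses the lens circles (and $0$ for a line).
   Formalization: The chain is assumed not to turn back (the two neighbours of a circle differ; A,B,A,B would violate the recurrence), and for an outer lens circles or lines separating the two lens circles are excluded, since admitting them makes the claim false. *)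

theory Defs
  imports "HOL-Analysis.Analysis"
begin

text \<open>Circles and lines are point sets in the Euclidean plane, modelled by \<^typ>\<open>complex\<close>.\<close>

definition is_circle :: "complex set \<Rightarrow> bool" where
  "is_circle S \<longleftrightarrow> (\<exists>z r. 0 < r \<and> S = sphere z r)"

definition is_line :: "complex set \<Rightarrow> bool" where
  "is_line S \<longleftrightarrow> (\<exists>u k. u \<noteq> 0 \<and> S = {z. u \<bullet> z = k})"

definition circle_radius :: "complex set \<Rightarrow> real" where
  "circle_radius S = (THE r. 0 < r \<and> (\<exists>z. S = sphere z r))"

text \<open>Tangency means exactly one common point in the plane extended by a point at infinity, which
  lies on every line and on no circle; so two lines are tangent iff they are parallel and distinct.\<close>

definition tangent :: "complex set \<Rightarrow> complex set \<Rightarrow> bool" where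
  "tangent S T \<longleftrightarrow> (if is_line S \<and> is_line T then S \<inter> T = {} else (\<exists>z. S \<inter> T = {z}))"

text \<open>The lens circles are \<^term>\<open>sphere p R\<close> and \<^term>\<open>sphere q R\<close>.\<close>

datatype lens_kind = Inner | Outer

fun lens :: "lens_kind \<Rightarrow> complex \<Rightarrow> complex \<Rightarrow> real \<Rightarrow> complex set" where
  "lens Inner p q R = ball p R \<inter> ball q R"
| "lens Outer p q R = - (cball p R \<union> cball q R)"

text \<open>For an outer lens, the chain circles have both lens circles on the same side (both outside,
  or both enclosed).  The last conjunct rules out the curves that touch both lens circles but
  separate them, such as the inner common tangents of two disjoint lens circles.\<close>

definition inscribed :: "lens_kind \<Rightarrow> complex \<Rightarrow> complex \<Rightarrow> real \<Rightarrow> complex set \<Rightarrow> bool" where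
  "inscribed K p q R S \<longleftrightarrow>
     (is_circle S \<or> is_line S) \<and>
     S \<subseteq> closure (lens K p q R) \<and>
     tangent S (sphere p R) \<and> tangent S (sphere q R) \<and>
     (K = Outer \<longrightarrow> connected_component (- S) p q)"

definition encloses :: "complex set \<Rightarrow> complex \<Rightarrow> complex \<Rightarrow> real \<Rightarrow> bool" where
  "encloses S p q R \<longleftrightarrow> (\<exists>z r. 0 < r \<and> S = sphere z r \<and> cball p R \<union> cball q R \<subseteq> cball z r)"

definition signed_curvature :: "complex \<Rightarrow> complex \<Rightarrow> real \<Rightarrow> complex set \<Rightarrow> real" where
  "signed_curvature p q R S =
     (if is_line S then 0
      else if encloses S p q R then - (1 / circle_radius S)
      else 1 / circle_radius S)"

text \<open>A chain is indexed by an interval \<open>I\<close> of integers, so it may be finite or infinite in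
  either direction.  The two neighbours of a circle in the chain are different circles: the chain
  does not turn back.  Circles further apart may coincide, as in a closed chain.\<close>

definition lens_chain ::
  "lens_kind \<Rightarrow> complex \<Rightarrow> complex \<Rightarrow> real \<Rightarrow> int set \<Rightarrow> (int \<Rightarrow> complex set) \<Rightarrow> bool" where
  "lens_chain K p q R I C \<longleftrightarrow>
     (\<forall>i\<in>I. \<forall>j\<in>I. {i..j} \<subseteq> I) \<and>
     (\<forall>n\<in>I. inscribed K p q R (C n)) \<and>
     (\<forall>n. n \<in> I \<and> n + 1 \<in> I \<longrightarrow> tangent (C n) (C (n + 1))) \<and>
     (\<forall>n. n \<in> I \<and> n + 2 \<in> I \<longrightarrow> C n \<noteq> C (n + 2))"

end

theory Submission
  imports Defs
begin

text \<open>All chain circles are centred on the axis of the lens.  Describe such a circle by its signed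
  curvature \<open>k\<close> and by \<open>x = k t\<close>, where \<open>t\<close> is the position of its centre on the axis; a line gets
  \<open>k = 0\<close> and \<open>x = 1\<close> or \<open>x = -1\<close>.  Tangency to the lens circles says that \<open>(k, x)\<close> lies on the conic
  \<open>x\<^sup>2 = D k\<^sup>2 + 2 E k + 1\<close>, where \<open>D = R\<^sup>2 - d\<^sup>2\<close>, \<open>2 d\<close> is the distance of the lens centres, and
  \<open>E\<close> is \<open>R\<close> for an outer and \<open>-R\<close> for an inner lens.  Two tangent chain circles have Lorentz product
  \<open>1\<close> or \<open>-1\<close>; the value \<open>1\<close> would force them to coincide.  Hence the two neighbours of \<open>(k, x)\<close> have
  as curvatures the two roots of one quadratic equation with leading coefficient \<open>d\<^sup>2\<close>.  The sum of
  the roots gives the recurrence with coefficients depending on \<open>R\<close> and \<open>d\<close> only, and sum and product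
  together express these coefficients through three consecutive curvatures.\<close>

section \<open>Algebra of the conic and of the curves it parametrises\<close>

definition on_conic :: "real \<Rightarrow> real \<Rightarrow> real \<Rightarrow> real \<Rightarrow> bool" where
  "on_conic D E k x \<longleftrightarrow> x\<^sup>2 = D * k\<^sup>2 + 2 * E * k + 1"

text \<open>For \<open>k \<noteq> 0\<close> and \<open>(k, x)\<close> on the conic this is the
  circle about \<open>m + (x / k) v\<close> of radius \<open>1 / |k|\<close>, and the constant term
  is \<open>k\<close> times the power of \<open>m\<close>. Avoiding division lets
  \<open>k = 0\<close> give the lines.\<close>

definition curve :: "complex \<Rightarrow> complex \<Rightarrow> real \<Rightarrow> real \<Rightarrow> real \<Rightarrow> real \<Rightarrow> complex set" where
  "curve m v D E k x =
     {w. k * (norm (w - m))\<^sup>2 - 2 * x * (v \<bullet> (w - m)) + (D * k + 2 * E) = 0}"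

text \<open>The polarisation of the quadratic form \<open>x\<^sup>2 - k l\<close> at two points with \<open>l = D k + 2 E\<close>.\<close>

definition chain_form :: "real \<Rightarrow> real \<Rightarrow> real \<Rightarrow> real \<Rightarrow> real \<Rightarrow> real \<Rightarrow> real" where
  "chain_form D E k x k' x' = x * x' - D * k * k' - E * (k + k')"

text \<open>The difference of the two points is isotropic, so for \<open>k \<noteq> k'\<close> their
  chord has an asymptotic direction of the conic. Such a line cannot meet a nondegenerate conic
  twice, and \<open>E\<^sup>2 = D\<close> is the degenerate case.\<close>

lemma conic_isotropic_eq:
  assumes "on_conic D E k x" "on_conic D E k' x'" "E\<^sup>2 \<noteq> D" "E \<noteq> 0"
    and "chain_form D E k x k' x' = 1"
  shows "k = k' \<and> x = x'"
proof -
  have c: "x\<^sup>2 = D * k\<^sup>2 + 2 * E * k + 1" "x'\<^sup>2 = D * k'\<^sup>2 + 2 * E * k' + 1"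
    "x * x' - D * k * k' - E * (k + k') = 1"
    using assms by (auto simp: on_conic_def chain_form_def)
  have sq: "(x - x')\<^sup>2 = D * (k - k')\<^sup>2"
    using c by algebra
  have "k = k'"
  proof (rule ccontr)
    assume ne: "k \<noteq> k'"
    have e: "(x - x') * (x + x') = (k - k') * (D * (k + k') + 2 * E)"
      using c by algebra
    have "(k - k')\<^sup>2 * (D * (x + x')\<^sup>2 - (D * (k + k') + 2 * E)\<^sup>2) = 0"
      using sq e by algebra
    then have 1: "D * (x + x')\<^sup>2 = (D * (k + k') + 2 * E)\<^sup>2"
      using ne by simp
    have "(x + x')\<^sup>2 = D * (k + k')\<^sup>2 + 4 * E * (k + k') + 4"
      using c by algebra
    with 1 have "E\<^sup>2 = D"
      by algebra
    with assms(3) show False ..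
  qed
  with sq show ?thesis by simp
qed

lemma conic_neighbours:
  assumes "on_conic D E k x" "on_conic D E k1 x1" "on_conic D E k2 x2"
    and "chain_form D E k x k1 x1 = - 1" "chain_form D E k x k2 x2 = - 1"
    and "(k1, x1) \<noteq> (k2, x2)" "E\<^sup>2 \<noteq> D"
  shows "(E\<^sup>2 - D) * (k1 + k2) = 2 * (E\<^sup>2 + D) * k + 4 * E"
    and "(E\<^sup>2 - D) * (k1 * k2) = (E\<^sup>2 - D) * k\<^sup>2 - 4 * E * k"
proof -
  have c: "x\<^sup>2 = D * k\<^sup>2 + 2 * E * k + 1"
    "x1\<^sup>2 = D * k1\<^sup>2 + 2 * E * k1 + 1" "x2\<^sup>2 = D * k2\<^sup>2 + 2 * E * k2 + 1"
    "x * x1 - D * k * k1 - E * (k + k1) = - 1" "x * x2 - D * k * k2 - E * (k + k2) = - 1"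
    using assms by (auto simp: on_conic_def chain_form_def)
  \<comment> \<open>Solve the Lorentz relation for \<open>x * x1\<close>, square, and remove
    \<open>x\<^sup>2\<close> and \<open>x1\<^sup>2\<close> by the conic. The same quadratic arises
    for \<open>k2\<close>.\<close>
  have q: "(E\<^sup>2 - D) * k1\<^sup>2 - (2 * (E\<^sup>2 + D) * k + 4 * E) * k1 + (E\<^sup>2 - D) * k\<^sup>2 - 4 * E * k = 0"
    "(E\<^sup>2 - D) * k2\<^sup>2 - (2 * (E\<^sup>2 + D) * k + 4 * E) * k2 + (E\<^sup>2 - D) * k\<^sup>2 - 4 * E * k = 0"
    using c by algebra+
  have "(E\<^sup>2 - D) * (k1 + k2) = 2 * (E\<^sup>2 + D) * k + 4 * E \<and>
    (E\<^sup>2 - D) * (k1 * k2) = (E\<^sup>2 - D) * k\<^sup>2 - 4 * E * k"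
  proof (cases "k1 = k2")
    case False
    have "(k1 - k2) * ((E\<^sup>2 - D) * (k1 + k2) - (2 * (E\<^sup>2 + D) * k + 4 * E)) = 0"
      using q by algebra
    then have s: "(E\<^sup>2 - D) * (k1 + k2) = 2 * (E\<^sup>2 + D) * k + 4 * E"
      using False by simp
    with q show ?thesis by algebra
  next
    case True
    then have "x1 \<noteq> x2" using assms(6) by simp
    have "x * (x1 - x2) = 0" using c True by algebra
    \<comment> \<open>The two neighbours are mirror images, and their curvature is a double root.\<close>
    then have x: "x = 0" using \<open>x1 \<noteq> x2\<close> by simp
    \<comment> \<open>With \<open>x = 0\<close>, \<open>k\<close> is a root of
      \<open>D k\<^sup>2 + 2 E k + 1\<close>. \<open>F\<close> is half the derivative there, so
      \<open>F\<^sup>2\<close> is a quarter of the discriminant.\<close>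
    define F where "F = D * k + E"
    have F2: "F\<^sup>2 = E\<^sup>2 - D" using c(1) x unfolding F_def by algebra
    have F1: "F * k1 = 1 - E * k" using c(4) x unfolding F_def by algebra
    have "(E\<^sup>2 - D) * (k1 + k2) = 2 * (E\<^sup>2 + D) * k + 4 * E"
      using F2 F1 True c(1) x unfolding F_def by algebra
    with q True show ?thesis by algebra
  qed
  then show "(E\<^sup>2 - D) * (k1 + k2) = 2 * (E\<^sup>2 + D) * k + 4 * E"
    and "(E\<^sup>2 - D) * (k1 * k2) = (E\<^sup>2 - D) * k\<^sup>2 - 4 * E * k"
    by blast+
qed

text \<open>This gives the form only up to sign; the sign is decided in
  \<open>tangent_curves_chain_form\<close>.\<close>

lemma curve_unique_common_point:
  assumes v: "norm v = 1" and c: "on_conic D E k x" "on_conic D E k' x'"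
    and w: "curve m v D E k x \<inter> curve m v D E k' x' = {w}"
  shows "(chain_form D E k x k' x')\<^sup>2 = 1"
proof -
  \<comment> \<open>Reflection in the axis preserves both curves, so a unique common point lies on the axis.\<close>
  define s where "s = v \<bullet> (w - m)"
  define w' where "w' = m + ((2 * s) *\<^sub>R v - (w - m))"
  have vv: "v \<bullet> v = 1" using v by (simp add: norm_eq_1)
  have "(norm (w' - m))\<^sup>2 = (norm (w - m))\<^sup>2"
    unfolding w'_def power2_norm_eq_inner
    by (simp add: s_def inner_diff vv inner_commute algebra_simps)
  moreover have "v \<bullet> (w' - m) = v \<bullet> (w - m)"
    by (simp add: w'_def s_def inner_diff_right inner_add_right vv)
  ultimately have "w' \<in> curve m v D E k x \<longleftrightarrow> w \<in> curve m v D E k x" for k x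
    unfolding curve_def by simp
  then have "w' = w" using w by blast
  then have "2 *\<^sub>R (w - m) = 2 *\<^sub>R (s *\<^sub>R v)"
    unfolding w'_def by (simp add: scaleR_2 algebra_simps)
  then have ws: "w - m = s *\<^sub>R v" by (rule scaleR_left_imp_eq[rotated]) simp
  then have "(norm (w - m))\<^sup>2 = s\<^sup>2" using v by simp
  moreover have "w \<in> curve m v D E k x" "w \<in> curve m v D E k' x'" using w by auto
  ultimately have e: "k * s\<^sup>2 - 2 * x * s + (D * k + 2 * E) = 0"
    "k' * s\<^sup>2 - 2 * x' * s + (D * k' + 2 * E) = 0"
    unfolding curve_def s_def by auto
  \<comment> \<open>For a circle, \<open>x - k * s\<close> is the curvature times the signed
    distance along the axis from the common point to the centre, hence 1 or -1. The form is the
    product of these two factors.\<close>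
  have "2 * chain_form D E k x k' x' = 2 * ((x - k * s) * (x' - k' * s))"
    unfolding chain_form_def using e by algebra
  moreover have "(x - k * s)\<^sup>2 = 1" using c(1) e(1) unfolding on_conic_def by algebra
  moreover have "(x' - k' * s)\<^sup>2 = 1" using c(2) e(2) unfolding on_conic_def by algebra
  ultimately show ?thesis by (simp add: power_mult_distrib)
qed

section \<open>Circles and lines as point sets in the plane\<close>

lemma circle_or_line_two_points:
  assumes "is_circle S \<or> is_line S"
  obtains y z where "y \<in> S" "z \<in> S" "y \<noteq> z"
  using assms
proof
  assume "is_circle S"
  then obtain c r where "0 < r" "S = sphere c r" by (auto simp: is_circle_def)
  then have "c + of_real r \<in> S" "c - of_real r \<in> S" "c + of_real r \<noteq> c - of_real r"
    by (auto simp: dist_norm complex_eq_iff)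
  then show ?thesis using that by blast
next
  assume "is_line S"
  then obtain u k where u: "u \<noteq> 0" "S = {z. u \<bullet> z = k}" by (auto simp: is_line_def)
  define y where "y = (k / (u \<bullet> u)) *\<^sub>R u"
  have "y \<in> S" using u by (simp add: y_def)
  moreover have "u \<bullet> (\<i> * u) = 0" by (simp add: inner_complex_def)
  then have "y + \<i> * u \<in> S" using \<open>y \<in> S\<close> u by (simp add: inner_add_right)
  ultimately show ?thesis using that u by force
qed

lemma line_unbounded:
  assumes "is_line S"
  shows "\<not> bounded S"
proof
  assume "bounded S"
  moreover have "affine S" using assms affine_hyperplane by (auto simp: is_line_def)
  ultimately have "S = {} \<or> (\<exists>a. S = {a})" using affine_bounded_eq_trivial by blast
  then show False using circle_or_line_two_points[of S] assms by (metis empty_iff singletonD)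
qed

lemma sphere_not_line: "\<not> is_line (sphere z r)"
  using line_unbounded bounded_sphere by metis

text \<open>Farthest and nearest points turn inclusions of a sphere in a disc or its complement into
  inequalities between distance and radii.\<close>

lemma sphere_farthest_point:
  fixes p z :: complex
  assumes "0 \<le> r"
  obtains w where "w \<in> sphere z r" "dist p w = dist p z + r"
proof (cases "p = z")
  case True
  then show ?thesis using assms that[of "z + of_real r"] by (simp add: dist_norm)
next
  case False
  define w where "w = z + (r / dist p z) *\<^sub>R (z - p)"
  have "w - p = (1 + r / dist p z) *\<^sub>R (z - p)" by (simp add: w_def algebra_simps)
  then have "dist w p = (1 + r / dist p z) * dist z p" using assms by (simp add: dist_norm)
  also have "\<dots> = dist p z + r" using False by (simp add: field_simps dist_commute)
  finally have "dist p w = dist p z + r" by (simp add: dist_commute)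
  moreover have "w \<in> sphere z r" using False assms
    by (simp add: w_def dist_norm norm_minus_commute)
  ultimately show ?thesis using that by blast
qed

text \<open>The farthest point of each sphere from the other centre gives \<open>r' = d + r\<close>
  and \<open>r = d + r'\<close> with \<open>d\<close> the distance of the centres, so
  \<open>d = 0\<close>. Hence the radius of a circle is well defined.\<close>

lemma sphere_eq_sphere_iff:
  fixes z z' :: complex
  assumes "0 < r" "0 < r'"
  shows "sphere z r = sphere z' r' \<longleftrightarrow> z = z' \<and> r = r'"
proof
  assume e: "sphere z r = sphere z' r'"
  obtain w where w: "w \<in> sphere z r" "dist z' w = dist z' z + r"
    using sphere_farthest_point[of r z z'] assms by auto
  obtain w' where w': "w' \<in> sphere z' r'" "dist z w' = dist z z' + r'"
    using sphere_farthest_point[of r' z' z] assms by auto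
  have "dist z' w = r'" "dist z w' = r" using w(1) w'(1) e by (metis mem_sphere)+
  then have "dist z z' = 0" "r = r'"
    using w(2) w'(2) zero_le_dist[of z z'] by (simp_all add: dist_commute)
  then show "z = z' \<and> r = r'" by simp
qed simp

lemma circle_radius_sphere:
  assumes "0 < r"
  shows "circle_radius (sphere z r) = r"
  unfolding circle_radius_def
proof (rule the_equality)
  show "0 < r \<and> (\<exists>z'. sphere z r = sphere z' r)" using assms by blast
qed (use assms sphere_eq_sphere_iff in metis)

lemma signed_curvature_sphere:
  assumes "0 < r"
  shows "signed_curvature p q R (sphere z r) =
    (if cball p R \<union> cball q R \<subseteq> cball z r then - (1 / r) else 1 / r)"
proof -
  have "\<not> is_line (sphere z r)" by (rule sphere_not_line)
  moreover have "encloses (sphere z r) p q R \<longleftrightarrow> cball p R \<union> cball q R \<subseteq> cball z r"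
    unfolding encloses_def using sphere_eq_sphere_iff assms by metis
  ultimately show ?thesis
    by (simp add: signed_curvature_def circle_radius_sphere assms)
qed

lemma sphere_nearest_point:
  fixes p z :: complex
  assumes "0 \<le> r"
  obtains w where "w \<in> sphere z r" "dist p w = \<bar>dist p z - r\<bar>"
proof (cases "p = z")
  case True
  then show ?thesis using assms that[of "z + of_real r"] by (simp add: dist_norm)
next
  case False
  define w where "w = z - (r / dist p z) *\<^sub>R (z - p)"
  have "w - p = (1 - r / dist p z) *\<^sub>R (z - p)" by (simp add: w_def algebra_simps)
  then have "dist w p = \<bar>1 - r / dist p z\<bar> * dist p z" by (simp add: dist_norm norm_minus_commute)
  also have "\<dots> = \<bar>(1 - r / dist p z) * dist p z\<bar>" by (simp add: abs_mult)
  also have "(1 - r / dist p z) * dist p z = dist p z - r" using False by (simp add: field_simps)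
  finally have "dist p w = \<bar>dist p z - r\<bar>" by (simp add: dist_commute)
  moreover have "w \<in> sphere z r" using False assms
    by (simp add: w_def dist_norm norm_minus_commute)
  ultimately show ?thesis using that by blast
qed

text \<open>Intermediate value theorem. With \<open>f\<close> vanishing exactly on a circle or line,
  it turns the connectedness clause of \<open>inscribed\<close> into \<open>p\<close> and
  \<open>q\<close> lying on the same side.\<close>

lemma connected_component_same_sign:
  fixes f :: "complex \<Rightarrow> real"
  assumes "connected_component T p q" "continuous_on UNIV f" "\<And>z. z \<in> T \<Longrightarrow> f z \<noteq> 0"
  shows "0 < f p \<longleftrightarrow> 0 < f q"
proof -
  obtain U where U: "connected U" "U \<subseteq> T" "p \<in> U" "q \<in> U"
    using assms(1) by (auto simp: connected_component_def)
  then have "connected (f ` U)" "0 \<notin> f ` U" "f p \<in> f ` U" "f q \<in> f ` U"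
    using connected_continuous_image continuous_on_subset[OF assms(2)] assms(3) by (blast, force+)
  then have "\<not> (f p \<le> 0 \<and> 0 \<le> f q)" "\<not> (f q \<le> 0 \<and> 0 \<le> f p)"
    using connected_contains_Icc[of "f ` U"] by (meson atLeastAtMost_iff subsetD)+
  then show ?thesis by linarith
qed

section \<open>The axis of the lens\<close>

text \<open>Multiplication by \<open>\<i>\<close> is a quarter turn, so this is a unit vector along
  the perpendicular bisector of \<open>p\<close> and \<open>q\<close>.\<close>

definition axis_dir :: "complex \<Rightarrow> complex \<Rightarrow> complex" where
  "axis_dir p q = \<i> * (p - q) / of_real (norm (p - q))"

lemma norm_axis_dir: "p \<noteq> q \<Longrightarrow> norm (axis_dir p q) = 1"
  by (simp add: axis_dir_def norm_mult norm_divide)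

lemma orthogonal_imp_axis:
  assumes "p \<noteq> q" "w \<bullet> (p - q) = 0"
  shows "w = (axis_dir p q \<bullet> w) *\<^sub>R axis_dir p q"
proof -
  define g where "g = p - q"
  have g: "(norm g)\<^sup>2 = (Re g)\<^sup>2 + (Im g)\<^sup>2" "norm g \<noteq> 0"
    using assms by (auto simp: g_def cmod_power2)
  have o: "Re w * Re g + Im w * Im g = 0" using assms(2) by (simp add: inner_complex_def g_def)
  have R: "Re (axis_dir p q) = - Im g / norm g" "Im (axis_dir p q) = Re g / norm g"
    by (auto simp: axis_dir_def g_def)
  have i: "axis_dir p q \<bullet> w = (Re g * Im w - Im g * Re w) / norm g"
    by (simp add: inner_complex_def R diff_divide_distrib)
  have "Re w * (norm g)\<^sup>2 = (Re g * Im w - Im g * Re w) * (- Im g)"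
    "Im w * (norm g)\<^sup>2 = (Re g * Im w - Im g * Re w) * Re g"
    using o g(1) by algebra+
  then have "Re w = (Re g * Im w - Im g * Re w) * (- Im g) / (norm g)\<^sup>2"
    "Im w = (Re g * Im w - Im g * Re w) * Re g / (norm g)\<^sup>2"
    using g(2) by (metis nonzero_eq_divide_eq power_not_zero)+
  then show ?thesis
    unfolding complex_eq_iff by (simp add: i R power2_eq_square)
qed

text \<open>The second claim is Pythagoras at the midpoint. The position \<open>t\<close> is signed,
  which \<open>x = k t\<close> requires.\<close>

lemma equidistant_imp_axis:
  assumes "p \<noteq> q" "dist p z = dist q z"
  obtains t where "z = midpoint p q + t *\<^sub>R axis_dir p q"
    and "(dist p z)\<^sup>2 = (dist p q / 2)\<^sup>2 + t\<^sup>2"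
proof -
  define w g where "w = z - midpoint p q" and "g = (1/2) *\<^sub>R (p - q)"
  have pz: "p - z = g - w" "q - z = - g - w"
    by (auto simp: w_def g_def midpoint_def complex_eq_iff field_simps)
  have n: "(dist p z)\<^sup>2 = (norm g)\<^sup>2 - 2 * (w \<bullet> g) + (norm w)\<^sup>2"
    "(dist q z)\<^sup>2 = (norm g)\<^sup>2 + 2 * (w \<bullet> g) + (norm w)\<^sup>2"
    unfolding dist_norm pz power2_norm_eq_inner by (auto simp: inner_diff inner_commute)
  with assms have wg: "w \<bullet> g = 0" by simp
  then have "w \<bullet> (p - q) = 0" by (simp add: g_def)
  then have w: "w = (axis_dir p q \<bullet> w) *\<^sub>R axis_dir p q"
    using orthogonal_imp_axis assms(1) by blast
  then have "norm w = \<bar>axis_dir p q \<bullet> w\<bar>"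
    by (metis norm_axis_dir[OF assms(1)] norm_scaleR mult.right_neutral)
  then have "(dist p z)\<^sup>2 = (dist p q / 2)\<^sup>2 + (axis_dir p q \<bullet> w)\<^sup>2"
    using n(1) wg by (simp add: g_def dist_norm)
  moreover have "z = midpoint p q + (axis_dir p q \<bullet> w) *\<^sub>R axis_dir p q"
    using w unfolding w_def by (simp add: algebra_simps)
  ultimately show ?thesis using that by blast
qed

text \<open>One relation covers all contacts: \<open>\<sigma>\<close> is the sign of the curvature,
  and \<open>r + \<sigma> * E\<close> is \<open>r - R\<close> inside the lens, \<open>r + R\<close>
  for external contact and \<open>r - R\<close> for an enclosing circle.\<close>

lemma sphere_eq_curve:
  assumes "p \<noteq> q" "0 < r" "\<sigma>\<^sup>2 = 1" "E\<^sup>2 = R\<^sup>2"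
    and "dist p z = dist q z" "(dist p z)\<^sup>2 = (r + \<sigma> * E)\<^sup>2"
  obtains x where "on_conic (R\<^sup>2 - (dist p q / 2)\<^sup>2) E (\<sigma> / r) x"
    and "sphere z r = curve (midpoint p q) (axis_dir p q) (R\<^sup>2 - (dist p q / 2)\<^sup>2) E (\<sigma> / r) x"
proof -
  define m v where "m = midpoint p q" and "v = axis_dir p q"
  obtain t where z: "z = m + t *\<^sub>R v" and t: "(dist p z)\<^sup>2 = (dist p q / 2)\<^sup>2 + t\<^sup>2"
    using equidistant_imp_axis assms(1,5) unfolding m_def v_def by metis
  define D k where "D = R\<^sup>2 - (dist p q / 2)\<^sup>2" and "k = \<sigma> / r"
  have vv: "v \<bullet> v = 1" using norm_axis_dir[OF assms(1)] by (simp add: v_def norm_eq_1)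
  have k: "k * r = \<sigma>" "k \<noteq> 0" using assms(2,3) by (auto simp: k_def)
  have D: "t\<^sup>2 = r\<^sup>2 + 2 * \<sigma> * E * r + D"
    using t assms(3,4,6) unfolding D_def by algebra
  have "k * \<sigma> * r = (k * r) * \<sigma>" by simp
  also have "\<dots> = 1" unfolding k(1) using assms(3) by (simp add: power2_eq_square)
  finally have ks: "k * \<sigma> * r = 1" .
  \<comment> \<open>The formula for \<open>t\<^sup>2\<close> times \<open>k\<^sup>2\<close>, grouped
    so that \<open>k * r = \<sigma>\<close> and \<open>k * \<sigma> * r = 1\<close> apply.\<close>
  have "(k * t)\<^sup>2 = (k * r)\<^sup>2 + 2 * E * k * (k * \<sigma> * r) + D * k\<^sup>2"
    using D by algebra
  then have "on_conic D E k (k * t)"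
    unfolding on_conic_def using k(1) ks assms(3) by simp
  moreover have "sphere z r = curve m v D E k (k * t)"
  proof (rule set_eqI)
    fix w
    define y where "y = w - m"
    have dzw: "(dist z w)\<^sup>2 = (norm y)\<^sup>2 - 2 * t * (v \<bullet> y) + t\<^sup>2"
    proof -
      have zw: "z - w = t *\<^sub>R v - y" by (simp add: z y_def)
      show ?thesis unfolding dist_norm zw power2_norm_eq_inner
        by (simp add: inner_diff inner_commute vv power2_eq_square)
    qed
    \<comment> \<open>The equation of the curve is \<open>k\<close> times the power of
      \<open>w\<close> with respect to the sphere, and \<open>k \<noteq> 0\<close>.\<close>
    have "k * ((dist z w)\<^sup>2 - r\<^sup>2) =
        k * (norm y)\<^sup>2 - 2 * (k * t) * (v \<bullet> y) + (D * k + 2 * E)"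
    proof -
      have "k * t\<^sup>2 = k * r\<^sup>2 + 2 * E * (k * \<sigma> * r) + k * D"
        unfolding D by (simp add: algebra_simps)
      then show ?thesis
        unfolding dzw ks by (simp add: algebra_simps)
    qed
    moreover have "w \<in> sphere z r \<longleftrightarrow> (dist z w)\<^sup>2 - r\<^sup>2 = 0"
      using assms(2) by simp
    moreover have "w \<in> curve m v D E k (k * t) \<longleftrightarrow>
        k * (norm y)\<^sup>2 - 2 * (k * t) * (v \<bullet> y) + (D * k + 2 * E) = 0"
      by (simp add: curve_def y_def)
    ultimately show "w \<in> sphere z r \<longleftrightarrow> w \<in> curve m v D E k (k * t)"
      using k(2) by (metis mult_eq_0_iff)
  qed
  ultimately show ?thesis using that unfolding D_def k_def m_def v_def by blast
qed

section \<open>Inscribed circles and lines as points of the conic\<close>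

fun lens_sign :: "lens_kind \<Rightarrow> real" where
  "lens_sign Inner = - 1"
| "lens_sign Outer = 1"

lemma closure_lens_Inner: "closure (lens Inner p q R) \<subseteq> cball p R \<inter> cball q R"
  by (rule closure_minimal) auto

lemma closure_lens_Outer: "closure (lens Outer p q R) \<subseteq> - (ball p R \<union> ball q R)"
  by (rule closure_minimal) (auto simp: closed_Compl)

lemma tangent_meets:
  assumes "tangent S (sphere p R)"
  obtains w where "w \<in> S" "dist p w = R"
proof -
  have "\<not> is_line (sphere p R)" by (rule sphere_not_line)
  then obtain w where "S \<inter> sphere p R = {w}" using assms unfolding tangent_def by auto
  then have "w \<in> S" "w \<in> sphere p R" by blast+
  then show ?thesis using that by simp
qed

lemma sphere_within_tangent_dist:
  assumes "0 < r" "sphere z r \<subseteq> cball p R" "tangent (sphere z r) (sphere p R)"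
  shows "dist p z = R - r"
proof -
  obtain w where w: "w \<in> sphere z r" "dist p w = R" using tangent_meets assms(3) .
  obtain w' where "w' \<in> sphere z r" "dist p w' = dist p z + r"
    using sphere_farthest_point assms(1) less_imp_le by metis
  then have "dist p z + r \<le> R" using assms(2) by (metis mem_cball subsetD)
  moreover have "R \<le> dist p z + r" using w dist_triangle[of p w z] by simp
  ultimately show ?thesis by simp
qed

text \<open>Nearest point and contact point give \<open>\<bar>dist p z - r\<bar> = R\<close>. The
  absolute value leaves external contact and enclosure both possible.\<close>

lemma sphere_outside_tangent_dist:
  assumes "0 < r" "sphere z r \<subseteq> - ball p R" "tangent (sphere z r) (sphere p R)"
  shows "dist p z = r + R \<or> dist p z = r - R"
proof -
  obtain w where w: "w \<in> sphere z r" "dist p w = R" using tangent_meets assms(3) .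
  obtain w' where "w' \<in> sphere z r" "dist p w' = \<bar>dist p z - r\<bar>"
    using sphere_nearest_point assms(1) less_imp_le by metis
  then have "R \<le> \<bar>dist p z - r\<bar>" using assms(2)
    by (metis ComplD mem_ball not_le subsetD)
  moreover have "\<bar>dist p z - r\<bar> \<le> R"
    using w dist_triangle[of p z w] dist_triangle[of w z p] by (simp add: dist_commute)
  ultimately show ?thesis by linarith
qed

lemma line_outside_tangent_dist:
  assumes "norm u = 1" "{z. u \<bullet> z = k} \<subseteq> - ball p R" "tangent {z. u \<bullet> z = k} (sphere p R)"
  shows "\<bar>u \<bullet> p - k\<bar> = R"
proof -
  obtain w where w: "u \<bullet> w = k" "dist p w = R" using tangent_meets assms(3) by blast
  have uu: "u \<bullet> u = 1" using assms(1) by (simp add: norm_eq_1)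
  \<comment> \<open>The foot of the perpendicular from \<open>p\<close> to the line.\<close>
  define w' where "w' = p - (u \<bullet> p - k) *\<^sub>R u"
  have "u \<bullet> w' = k" by (simp add: w'_def inner_diff_right uu)
  then have "w' \<notin> ball p R" using assms(2) by blast
  then have "R \<le> dist p w'" by simp
  also have "dist p w' = \<bar>u \<bullet> p - k\<bar>" by (simp add: w'_def dist_norm assms(1))
  finally have "R \<le> \<bar>u \<bullet> p - k\<bar>" .
  moreover have "\<bar>u \<bullet> p - k\<bar> \<le> R"
    using Cauchy_Schwarz_ineq2[of u "p - w"] w assms(1) by (simp add: inner_diff_right dist_norm)
  ultimately show ?thesis by simp
qed

lemma inscribed_circle_curve:
  assumes "0 < R" "p \<noteq> q" "inscribed K p q R S" "is_circle S"
  obtains x where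
    "on_conic (R\<^sup>2 - (dist p q / 2)\<^sup>2) (lens_sign K * R) (signed_curvature p q R S) x"
    "S = curve (midpoint p q) (axis_dir p q) (R\<^sup>2 - (dist p q / 2)\<^sup>2) (lens_sign K * R)
       (signed_curvature p q R S) x"
proof -
  obtain z r where r: "0 < r" and S: "S = sphere z r" using assms(4) by (auto simp: is_circle_def)
  have sub: "sphere z r \<subseteq> closure (lens K p q R)"
    and tan: "tangent (sphere z r) (sphere p R)" "tangent (sphere z r) (sphere q R)"
    using assms(3) by (auto simp: inscribed_def S)
  have "\<exists>\<sigma>. \<sigma>\<^sup>2 = 1 \<and> signed_curvature p q R S = \<sigma> / r \<and> dist p z = dist q z \<and>
    (dist p z)\<^sup>2 = (r + \<sigma> * (lens_sign K * R))\<^sup>2"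
  proof (cases K)
    case Inner
    then have "sphere z r \<subseteq> cball p R" "sphere z r \<subseteq> cball q R"
      using sub closure_lens_Inner by blast+
    then have d: "dist p z = R - r" "dist q z = R - r"
      using sphere_within_tangent_dist r tan by blast+
    \<comment> \<open>So the curvature is positive: enclosing would force both lens centres to equal
      \<open>z\<close>.\<close>
    have "\<not> cball p R \<subseteq> cball z r"
    proof
      assume "cball p R \<subseteq> cball z r"
      then have "dist p z + R \<le> r" using assms(1) by (simp add: cball_subset_cball_iff)
      then have "dist p z \<le> 0" "dist q z \<le> 0" using d by linarith+
      then have "p = z" "q = z" by simp_all
      then show False using assms(2) by simp
    qed
    then show ?thesis using Inner d r
      by (intro exI[of _ 1]) (simp add: S signed_curvature_sphere power2_commute)
  next
    case Outer
    then have "sphere z r \<subseteq> - ball p R" "sphere z r \<subseteq> - ball q R"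
      using sub closure_lens_Outer by blast+
    then have d: "dist p z = r + R \<or> dist p z = r - R" "dist q z = r + R \<or> dist q z = r - R"
      using sphere_outside_tangent_dist r tan by blast+
    have "connected_component (- sphere z r) p q" using assms(3) Outer by (simp add: inscribed_def S)
    \<comment> \<open>This excludes a circle that encloses one lens circle and touches the other
      from outside.\<close>
    then have "0 < dist p z - r \<longleftrightarrow> 0 < dist q z - r"
      by (rule connected_component_same_sign) (auto intro!: continuous_intros simp: dist_commute)
    with d assms(1) consider "dist p z = r + R" "dist q z = r + R" | "dist p z = r - R" "dist q z = r - R"
      by auto
    then show ?thesis
    proof cases
      case 1
      then have "\<not> cball p R \<subseteq> cball z r" using assms(1) by (simp add: cball_subset_cball_iff)
      then show ?thesis using Outer 1 r
        by (intro exI[of _ 1]) (simp add: S signed_curvature_sphere)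
    next
      case 2
      then have "cball p R \<union> cball q R \<subseteq> cball z r" by (simp add: cball_subset_cball_iff)
      then show ?thesis using Outer 2 r
        by (intro exI[of _ "-1"]) (simp add: S signed_curvature_sphere)
    qed
  qed
  then obtain \<sigma> where s: "\<sigma>\<^sup>2 = 1" "signed_curvature p q R S = \<sigma> / r" "dist p z = dist q z"
    "(dist p z)\<^sup>2 = (r + \<sigma> * (lens_sign K * R))\<^sup>2" by blast
  have "(lens_sign K * R)\<^sup>2 = R\<^sup>2" by (cases K) auto
  from sphere_eq_curve[OF assms(2) r s(1) this s(3,4)] obtain x where
    "on_conic (R\<^sup>2 - (dist p q / 2)\<^sup>2) (lens_sign K * R) (\<sigma> / r) x"
    "sphere z r = curve (midpoint p q) (axis_dir p q) (R\<^sup>2 - (dist p q / 2)\<^sup>2) (lens_sign K * R)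
       (\<sigma> / r) x" .
  then show ?thesis unfolding S[symmetric] s(2)[symmetric] by (rule that)
qed

text \<open>An inner lens is bounded, so the lens is outer. With both centres on the same side at
  distance \<open>R\<close>, the line is parallel to \<open>p - q\<close>, hence perpendicular to
  the axis.\<close>

lemma inscribed_line_curve:
  assumes "0 < R" "p \<noteq> q" "inscribed K p q R S" "is_line S"
  obtains x where
    "on_conic (R\<^sup>2 - (dist p q / 2)\<^sup>2) (lens_sign K * R) (signed_curvature p q R S) x"
    "S = curve (midpoint p q) (axis_dir p q) (R\<^sup>2 - (dist p q / 2)\<^sup>2) (lens_sign K * R)
       (signed_curvature p q R S) x"
proof -
  define m v where "m = midpoint p q" and "v = axis_dir p q"
  have sub: "S \<subseteq> closure (lens K p q R)" using assms(3) by (simp add: inscribed_def)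
  have K: "K = Outer"
  proof (cases K)
    case Inner
    then have "S \<subseteq> cball p R" using sub closure_lens_Inner by blast
    then show ?thesis using line_unbounded assms(4) bounded_subset bounded_cball by blast
  qed
  obtain u0 k0 where u0: "u0 \<noteq> 0" "S = {z. u0 \<bullet> z = k0}" using assms(4) by (auto simp: is_line_def)
  define u k where "u = u0 /\<^sub>R norm u0" and "k = k0 / norm u0"
  have u: "norm u = 1" using u0 by (simp add: u_def)
  have S: "S = {z. u \<bullet> z = k}" using u0 by (auto simp: u_def k_def divide_inverse)
  have "S \<subseteq> - ball p R" "S \<subseteq> - ball q R" using sub K closure_lens_Outer by blast+
  then have d: "\<bar>u \<bullet> p - k\<bar> = R" "\<bar>u \<bullet> q - k\<bar> = R"
    using line_outside_tangent_dist u assms(3) unfolding S inscribed_def by blast+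
  have "connected_component (- S) p q" using assms(3) K by (simp add: inscribed_def)
  then have "0 < u \<bullet> p - k \<longleftrightarrow> 0 < u \<bullet> q - k"
    by (rule connected_component_same_sign) (auto intro!: continuous_intros simp: S)
  with d have pq: "u \<bullet> p = u \<bullet> q" by linarith
  then have "u \<bullet> (p - q) = 0" by (simp add: inner_diff_right)
  then have uv: "u = (v \<bullet> u) *\<^sub>R v" using orthogonal_imp_axis assms(2) unfolding v_def by blast
  define l where "l = v \<bullet> u"
  have "norm u = \<bar>l\<bar>" using uv norm_axis_dir[OF assms(2)] unfolding l_def v_def
    by (metis norm_scaleR mult.right_neutral)
  then have l: "l\<^sup>2 = 1" using u by (simp add: abs_square_eq_1)
  define h where "h = k - u \<bullet> m"
  have "u \<bullet> m = u \<bullet> p" using pq by (simp add: m_def midpoint_def inner_add_right)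
  then have h: "h\<^sup>2 = R\<^sup>2" using d by (metis h_def power2_abs power2_commute)
  \<comment> \<open>\<open>l * h\<close> is the position where the line cuts the axis. It is
    \<open>R\<close> or \<open>-R\<close>, and \<open>x\<close> is its sign.\<close>
  define x where "x = l * h / R"
  have xR: "x * R = l * h" using assms(1) by (simp add: x_def)
  have "x\<^sup>2 = 1" using l h assms(1) by (simp add: x_def power_mult_distrib power_divide)
  then have "on_conic (R\<^sup>2 - (dist p q / 2)\<^sup>2) (lens_sign K * R) (signed_curvature p q R S) x"
    using assms(4) by (simp add: on_conic_def signed_curvature_def)
  moreover have "S = curve m v (R\<^sup>2 - (dist p q / 2)\<^sup>2) (lens_sign K * R)
       (signed_curvature p q R S) x"
  proof -
    have "u \<bullet> w = k \<longleftrightarrow> x * (v \<bullet> (w - m)) = R" for w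
    proof -
      have "u \<bullet> w = k \<longleftrightarrow> u \<bullet> (w - m) = h" by (simp add: h_def inner_diff_right)
      also have "u \<bullet> (w - m) = l * (v \<bullet> (w - m))" using uv l_def by (metis inner_scaleR_left)
      also have "l * (v \<bullet> (w - m)) = h \<longleftrightarrow> x * (v \<bullet> (w - m)) = R"
      proof -
        have "h * (l * y - h) = R * (x * y - R)" for y
          using xR h by algebra
        moreover have "h \<noteq> 0" using h assms(1) by auto
        ultimately show ?thesis using assms(1)
          by (metis eq_iff_diff_eq_0 less_irrefl mult_eq_0_iff)
      qed
      finally show ?thesis .
    qed
    then show ?thesis using K assms(4) by (auto simp: S curve_def signed_curvature_def)
  qed
  ultimately show ?thesis using that unfolding m_def v_def by blast
qed

section \<open>Tangent neighbours and the recurrence\<close>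

text \<open>The value 1 would make \<open>S\<close> and \<open>T\<close> equal, but a set tangent to
  itself has at most one point. Parallel lines have no common point in the plane; there the form is
  just \<open>x * x'\<close> with both factors 1 or -1.\<close>

lemma tangent_curves_chain_form:
  assumes v: "norm v = 1" and c: "on_conic D E k x" "on_conic D E k' x'"
    and S: "S = curve m v D E k x" "T = curve m v D E k' x'"
    and nd: "E\<^sup>2 \<noteq> D" "E \<noteq> 0"
    and CL: "is_circle S \<or> is_line S"
    and k: "is_line S \<Longrightarrow> k = 0" "is_line T \<Longrightarrow> k' = 0"
    and tan: "tangent S T"
  shows "chain_form D E k x k' x' = - 1"
proof -
  obtain y z where yz: "y \<in> S" "z \<in> S" "y \<noteq> z" using circle_or_line_two_points[OF CL] .
  have "S \<noteq> T"
  proof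
    assume "S = T"
    then have "S = {} \<or> (\<exists>w. S = {w})" using tan by (auto simp: tangent_def split: if_splits)
    then show False using yz by auto
  qed
  then have "chain_form D E k x k' x' \<noteq> 1" using conic_isotropic_eq[OF c nd] S by auto
  moreover have "(chain_form D E k x k' x')\<^sup>2 = 1"
  proof (cases "is_line S \<and> is_line T")
    case True
    then have "k = 0" "k' = 0" using k by auto
    then show ?thesis using c by (simp add: on_conic_def chain_form_def power_mult_distrib)
  next
    case False
    then obtain w where "S \<inter> T = {w}" using tan unfolding tangent_def by metis
    then show ?thesis using curve_unique_common_point[OF v c] S by blast
  qed
  ultimately show ?thesis by (simp add: power2_eq_1_iff)
qed

theorem theorem2p5:
  fixes K :: lens_kind and p q :: complex and R :: real
    and I :: "int set" and C :: "int \<Rightarrow> complex set"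
    and bs :: "int \<Rightarrow> real" and a b c \<alpha> \<beta> :: real
  assumes "0 < R" and "p \<noteq> q"
    and "lens_chain K p q R I C"
    and "{0, 1, 2} \<subseteq> I"
    and "\<And>n. n \<in> I \<Longrightarrow> bs n = signed_curvature p q R (C n)"
    and "a = signed_curvature p q R (C 0)"
    and "b = signed_curvature p q R (C 1)"
    and "c = signed_curvature p q R (C 2)"
    and "b \<noteq> 0"
    and "\<alpha> = (a * b + b * c + c * a) / b\<^sup>2 - 1"
    and "\<beta> = (b\<^sup>2 - a * c) / b"
  shows "(\<forall>n. n \<in> I \<and> n - 2 \<in> I \<longrightarrow> bs n = \<alpha> * bs (n - 1) - bs (n - 2) + \<beta>)
    \<and> bs 2 = c \<and> \<alpha> * b + \<beta> = a + c"
proof -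
  define d where "d = dist p q / 2"
  define D E where "D = R\<^sup>2 - d\<^sup>2" and "E = lens_sign K * R"
  define m v where "m = midpoint p q" and "v = axis_dir p q"
  have E2: "E\<^sup>2 = R\<^sup>2" by (cases K) (auto simp: E_def)
  \<comment> \<open>Distinct lens centres make the conic nondegenerate.\<close>
  then have ED: "E\<^sup>2 - D = d\<^sup>2" "E\<^sup>2 \<noteq> D" "E \<noteq> 0" "d \<noteq> 0"
    using assms(1,2) by (auto simp: D_def d_def)
  note chain = assms(3)[unfolded lens_chain_def]
  have "\<exists>x. on_conic D E (bs n) x \<and> C n = curve m v D E (bs n) x" if "n \<in> I" for n
  proof -
    have ins: "inscribed K p q R (C n)" using chain that by blast
    then have "is_circle (C n) \<or> is_line (C n)" by (simp add: inscribed_def)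
    then show ?thesis
      using inscribed_circle_curve[OF assms(1,2) ins] inscribed_line_curve[OF assms(1,2) ins]
        assms(5)[OF that] unfolding D_def E_def m_def v_def d_def by metis
  qed
  then obtain x where x: "\<And>n. n \<in> I \<Longrightarrow> on_conic D E (bs n) (x n)"
    "\<And>n. n \<in> I \<Longrightarrow> C n = curve m v D E (bs n) (x n)"
    by metis
  have line: "bs n = 0" if "is_line (C n)" "n \<in> I" for n
    using that assms(5) by (simp add: signed_curvature_def)
  have step: "chain_form D E (bs n) (x n) (bs (n + 1)) (x (n + 1)) = - 1"
    if "n \<in> I" "n + 1 \<in> I" for n
  proof (rule tangent_curves_chain_form)
    show "norm v = 1" using norm_axis_dir assms(2) by (simp add: v_def)
    show "is_circle (C n) \<or> is_line (C n)" using chain that by (auto simp: inscribed_def)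
    show "tangent (C n) (C (n + 1))" using chain that by blast
  qed (use x line that ED in auto)
  have vieta: "d\<^sup>2 * (bs n + bs (n + 2)) = 2 * (E\<^sup>2 + D) * bs (n + 1) + 4 * E"
    "d\<^sup>2 * (bs n * bs (n + 2)) = d\<^sup>2 * (bs (n + 1))\<^sup>2 - 4 * E * bs (n + 1)"
    if n: "n \<in> I" "n + 2 \<in> I" for n
  proof -
    have "{n..n + 2} \<subseteq> I" using chain n by blast
    then have n1: "n + 1 \<in> I" by auto
    have "C n \<noteq> C (n + 2)" using chain n by blast
    \<comment> \<open>Coordinates determine the curve, so a chain that does not turn back has
      different neighbour coordinates, even when their curvatures agree.\<close>
    then have ne: "(bs n, x n) \<noteq> (bs (n + 2), x (n + 2))" using x(2) n by auto
    have "chain_form D E (bs (n + 1)) (x (n + 1)) (bs n) (x n) = - 1"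
      using step[OF n(1) n1] by (simp add: chain_form_def algebra_simps)
    moreover have "chain_form D E (bs (n + 1)) (x (n + 1)) (bs (n + 2)) (x (n + 2)) = - 1"
      using step[of "n + 1"] n1 n(2) by (simp add: add.assoc)
    ultimately show "d\<^sup>2 * (bs n + bs (n + 2)) = 2 * (E\<^sup>2 + D) * bs (n + 1) + 4 * E"
      "d\<^sup>2 * (bs n * bs (n + 2)) = d\<^sup>2 * (bs (n + 1))\<^sup>2 - 4 * E * bs (n + 1)"
      using conic_neighbours[OF x(1)[OF n1] x(1)[OF n(1)] x(1)[OF n(2)] _ _ ne ED(2)]
      unfolding ED(1) by blast+
  qed
  have I: "0 \<in> I" "1 \<in> I" "2 \<in> I" using assms(4) by auto
  have abc: "bs 0 = a" "bs 1 = b" "bs 2 = c" using assms(5-8) I by auto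
  have v0: "d\<^sup>2 * (a + c) = 2 * (E\<^sup>2 + D) * b + 4 * E" "d\<^sup>2 * (a * c) = d\<^sup>2 * b\<^sup>2 - 4 * E * b"
    using vieta[of 0] I abc by auto
  have ab: "\<alpha> * b\<^sup>2 = a * b + b * c + c * a - b\<^sup>2" "\<beta> * b = b\<^sup>2 - a * c"
    using assms(9-11) by (simp_all add: field_simps)
  \<comment> \<open>The product of the roots determines \<open>\<beta>\<close>; sum and product
    together determine \<open>\<alpha>\<close>. Cancelling \<open>b\<close> shows that both depend
    only on the lens, so they serve every triple of the chain.\<close>
  have "b * (d\<^sup>2 * \<beta> - 4 * E) = 0" using v0 ab by algebra
  then have \<beta>: "d\<^sup>2 * \<beta> = 4 * E" using assms(9) by simp
  have "b\<^sup>2 * (d\<^sup>2 * \<alpha> - 2 * (E\<^sup>2 + D)) = 0" using v0 ab by algebra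
  then have \<alpha>: "d\<^sup>2 * \<alpha> = 2 * (E\<^sup>2 + D)" using assms(9) by simp
  have rec: "bs n + bs (n + 2) = \<alpha> * bs (n + 1) + \<beta>" if "n \<in> I" "n + 2 \<in> I" for n
  proof -
    have "d\<^sup>2 * (bs n + bs (n + 2) - (\<alpha> * bs (n + 1) + \<beta>)) = 0"
      using vieta(1)[OF that] \<alpha> \<beta> by algebra
    then show ?thesis using ED(4) by simp
  qed
  have "bs n = \<alpha> * bs (n - 1) - bs (n - 2) + \<beta>" if "n \<in> I" "n - 2 \<in> I" for n
    using rec[of "n - 2"] that by (simp add: algebra_simps)
  moreover have "\<alpha> * b + \<beta> = a + c" using rec[of 0] I abc by simp
  ultimately show ?thesis using abc(3) by blast
qed

end
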